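(* Let $\mathbb{F}$ be a field, let $W(t)=\sum_{n=0}^{\infty}\frac{t^n}{w_n}\in\mathbb{F}[[t]]$ with $w_0=1$ and $w_n\neq 0$ for all $n$, and let $A=(a_{n,k})\in L$. Put $p_n(x)=\sum_{k=0}^{n}a_{n,k}x^k$. Then $A$ is a $W$-Riordan array if and only if the element $\sum_{n=0}^{\infty}p_n(x)\frac{y^n}{w_n}$ of $\mathbb{F}[x][[y]]$ is of the form $\alpha(y)W\big(x\beta(y)\big)$ for some power series $\alpha,\beta\in\mathbb{F}[[y]]$ with $v(\alpha)=0$ and $v(\beta)=1$.
   Context: $\mathbb{N}=\{0,1,2,\dots\}$. $L$ is the group, under matrix multiplication, of infinite lower triangular matrices $A=(a_{n,k})_{n,k\in\mathbb{N}}$ over $\mathbb{F}$ with all diagonal entries non-zero. For a non-zero $C=\sum_n c_ny^n\in\mathbb{F}[[y]]$ the valuation $v(C)$ is the minimal $n$ with $c_n\neq0$, and $v(0)=\infty$. For $A\in L$ and $k\in\mathbb{N}$ put $C_k(y)=\sum_{n=0}^{\infty}a_{n,k}\frac{y^n}{w_n}\in\mathbb{F}[[y]]$ (which has valuation $k$). $A$ is called a $W$-Riordan array if the quotient $\frac{w_{k+1}C_{k+1}}{w_kC_k}$ (a power series of valuation 1) is independent of $k$. *)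

theory Defs
  imports
    "HOL-Computational_Algebra.Computational_Algebra"
    "HOL-Library.Extended_Nat"
begin

definition lower_triangular_matrices :: "(nat \<Rightarrow> nat \<Rightarrow> 'a::field) set" where
  "lower_triangular_matrices =
     {A. (\<forall>n k. n < k \<longrightarrow> A n k = 0) \<and> (\<forall>n. A n n \<noteq> 0)}"

(* Unlike subdegree, which maps the zero series to 0, this maps it to infinity. *)
definition valuation :: "'a::zero fps \<Rightarrow> enat" where
  "valuation C = (if C = 0 then \<infinity> else enat (subdegree C))"

definition W_series :: "(nat \<Rightarrow> 'a::field) \<Rightarrow> 'a fps" where
  "W_series w = Abs_fps (\<lambda>n. 1 / w n)"

definition column_series :: "(nat \<Rightarrow> 'a::field) \<Rightarrow> (nat \<Rightarrow> nat \<Rightarrow> 'a) \<Rightarrow> nat \<Rightarrow> 'a fps" where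
  "column_series w A k = Abs_fps (\<lambda>n. A n k / w n)"

lemma valuation_column_series:
  assumes "A \<in> lower_triangular_matrices" and "\<And>n. w n \<noteq> 0"
  shows "valuation (column_series w A k) = enat k"
proof -
  have nz: "column_series w A k $ k \<noteq> 0"
    using assms by (simp add: column_series_def lower_triangular_matrices_def)
  moreover have "column_series w A k $ i = 0" if "i < k" for i
    using assms that by (simp add: column_series_def lower_triangular_matrices_def)
  ultimately have "subdegree (column_series w A k) = k"
    by (intro subdegreeI) auto
  moreover have "column_series w A k \<noteq> 0"
    using nz by auto
  ultimately show ?thesis
    by (simp add: valuation_def)
qed

definition column_quotient :: "(nat \<Rightarrow> 'a::field) \<Rightarrow> (nat \<Rightarrow> nat \<Rightarrow> 'a) \<Rightarrow> nat \<Rightarrow> 'a fps" where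
  "column_quotient w A k =
     (fps_const (w (Suc k)) * column_series w A (Suc k)) / (fps_const (w k) * column_series w A k)"

(* By the lemma on valuations above, the division of power series in column_quotient is exact
   for A in lower_triangular_matrices and w nowhere zero. *)
definition W_Riordan_array :: "(nat \<Rightarrow> 'a::field) \<Rightarrow> (nat \<Rightarrow> nat \<Rightarrow> 'a) \<Rightarrow> bool" where
  "W_Riordan_array w A \<longleftrightarrow>
     A \<in> lower_triangular_matrices \<and> (\<forall>j k. column_quotient w A j = column_quotient w A k)"

definition row_poly :: "(nat \<Rightarrow> nat \<Rightarrow> 'a::field) \<Rightarrow> nat \<Rightarrow> 'a poly" where
  "row_poly A n = (\<Sum>k=0..n. monom (A n k) k)"

(* F[x][[y]] is the type 'a poly fps; the outer variable of the fps is y, the poly variable is x. *)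
definition row_poly_series :: "(nat \<Rightarrow> 'a::field) \<Rightarrow> (nat \<Rightarrow> nat \<Rightarrow> 'a) \<Rightarrow> 'a poly fps" where
  "row_poly_series w A = Abs_fps (\<lambda>n. smult (1 / w n) (row_poly A n))"

(* The inclusion of F[[y]] in F[x][[y]] by constant polynomials. *)
definition fps_lift_poly :: "'a::field fps \<Rightarrow> 'a poly fps" where
  "fps_lift_poly C = Abs_fps (\<lambda>n. [:C $ n:])"

(* W(x B(y)) in F[x][[y]]. The composition oo is the usual substitution as the inner series has
   zero constant term in y, that is, for B of positive valuation. *)
definition subst_x_mult :: "'a::field fps \<Rightarrow> 'a fps \<Rightarrow> 'a poly fps" where
  "subst_x_mult W B = fps_lift_poly W oo (fps_const [:0, 1:] * fps_lift_poly B)"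

end

theory Submission
  imports Defs
begin

text \<open>
  Put \<open>D\<^sub>k = w\<^sub>k C\<^sub>k\<close>, a power series of valuation \<open>k\<close>. Both sides of the equivalence say that the
  sequence \<open>D\<close> is geometric, i.e. \<open>D\<^sub>k = \<alpha> \<beta>\<^sup>k\<close> for all \<open>k\<close>.

  For the Riordan property (lemma \<open>W_Riordan_array_iff_geometric\<close>), a constant quotient \<open>\<beta>\<close> of consecutive terms gives
  \<open>D\<^sub>k = D\<^sub>0 \<beta>\<^sup>k\<close>, and the valuations of \<open>D\<^sub>0\<close> and \<open>D\<^sub>1 = D\<^sub>0 \<beta>\<close> are 0 and 1. For the bivariate
  generating function, sort \<open>F[x][[y]]\<close> by powers of \<open>x\<close>: an element is determined by the sequence
  of its \<open>x\<^sup>k\<close>-coefficients in \<open>F[[y]]\<close>. The \<open>x\<^sup>k\<close>-coefficient of the generating function of the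
  row polynomials is the column series \<open>C\<^sub>k\<close> (lemma \<open>x_coeff_row_poly_series\<close>), and the one of
  \<open>\<alpha>(y) W(x \<beta>(y))\<close> is \<open>\<alpha> \<beta>\<^sup>k / w\<^sub>k\<close> (lemmas \<open>x_coeff_lift_mult\<close> and \<open>x_coeff_subst_x_mult\<close>).
\<close>

definition x_coeff :: "nat \<Rightarrow> 'a::zero poly fps \<Rightarrow> 'a fps" where
  "x_coeff k F = Abs_fps (\<lambda>n. coeff (F $ n) k)"

lemma x_coeff_nth [simp]: "x_coeff k F $ n = coeff (F $ n) k"
  by (simp add: x_coeff_def)

lemma fps_poly_eq_iff_x_coeff: "F = G \<longleftrightarrow> (\<forall>k. x_coeff k F = x_coeff k G)"
  by (auto simp: fps_eq_iff poly_eq_iff)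

lemma fps_lift_poly_nth [simp]: "fps_lift_poly C $ n = [:C $ n:]"
  by (simp add: fps_lift_poly_def)

lemma fps_lift_poly_one: "fps_lift_poly 1 = 1"
  by (simp add: fps_eq_iff one_pCons)

lemma fps_lift_poly_mult: "fps_lift_poly (B * C) = fps_lift_poly B * fps_lift_poly C"
proof (rule fps_ext, rule poly_eqI)
  fix n k
  show "coeff (fps_lift_poly (B * C) $ n) k = coeff ((fps_lift_poly B * fps_lift_poly C) $ n) k"
    by (cases k) (simp_all add: fps_mult_nth coeff_sum mult.commute)
qed

lemma fps_lift_poly_power: "fps_lift_poly (C ^ n) = fps_lift_poly C ^ n"
  by (induction n) (simp_all add: fps_lift_poly_one fps_lift_poly_mult)

lemma x_coeff_lift_mult: "x_coeff k (fps_lift_poly C * F) = C * x_coeff k F"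
  by (rule fps_ext) (simp add: fps_mult_nth coeff_sum)

text \<open>
  The composition of formal power series truncates the sum over the powers of the inner series at
  the index of the requested coefficient. The zero constant term of \<open>B\<close> makes the omitted terms
  vanish.
\<close>
lemma x_coeff_subst_x_mult:
  assumes "B $ 0 = 0"
  shows "x_coeff k (subst_x_mult W B) = fps_const (W $ k) * B ^ k"
proof (rule fps_ext)
  fix n
  have pow: "(fps_const [:0, 1:] * fps_lift_poly B) ^ i $ n = monom (B ^ i $ n) i" for i
  proof -
    have "(fps_const [:0, 1:] * fps_lift_poly B) ^ i $ n = [:0, 1:] ^ i * [:B ^ i $ n:]"
      by (simp add: power_mult_distrib flip: fps_lift_poly_power)
    also have "\<dots> = monom (B ^ i $ n) i"
      by (simp add: monom_altdef)
    finally show ?thesis .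
  qed
  have "x_coeff k (subst_x_mult W B) $ n = (\<Sum>i=0..n. if i = k then W $ i * B ^ i $ n else 0)"
    unfolding subst_x_mult_def x_coeff_nth fps_compose_nth pow coeff_sum
    by (intro sum.cong) simp_all
  also have "\<dots> = (if k \<le> n then W $ k * B ^ k $ n else 0)"
    by simp
  also have "\<dots> = (fps_const (W $ k) * B ^ k) $ n"
    using startsby_zero_power_prefix[OF assms, rule_format, of n k] by simp
  finally show "x_coeff k (subst_x_mult W B) $ n = (fps_const (W $ k) * B ^ k) $ n" .
qed

lemma coeff_row_poly:
  assumes "A \<in> lower_triangular_matrices"
  shows "coeff (row_poly A n) k = A n k"
  using assms by (simp add: row_poly_def coeff_sum lower_triangular_matrices_def)

lemma x_coeff_row_poly_series:
  assumes "A \<in> lower_triangular_matrices"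
  shows "x_coeff k (row_poly_series w A) = column_series w A k"
  by (rule fps_ext) (simp add: row_poly_series_def column_series_def coeff_row_poly[OF assms])

definition scaled_column :: "(nat \<Rightarrow> 'a::field) \<Rightarrow> (nat \<Rightarrow> nat \<Rightarrow> 'a) \<Rightarrow> nat \<Rightarrow> 'a fps" where
  "scaled_column w A k = fps_const (w k) * column_series w A k"

lemma row_poly_series_factorization_iff:
  fixes w :: "nat \<Rightarrow> 'a::field"
  assumes w: "\<And>n. w n \<noteq> 0" and A: "A \<in> lower_triangular_matrices" and "\<beta> $ 0 = 0"
  shows "row_poly_series w A = fps_lift_poly \<alpha> * subst_x_mult (W_series w) \<beta> \<longleftrightarrow>
    (\<forall>k. scaled_column w A k = \<alpha> * \<beta> ^ k)"
proof -
  have "column_series w A k = \<alpha> * (fps_const (1 / w k) * \<beta> ^ k) \<longleftrightarrow>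
      scaled_column w A k = \<alpha> * \<beta> ^ k" for k
  proof -
    have inv: "fps_const (w k) * fps_const (1 / w k) = 1"
      using w[of k] by simp
    have "column_series w A k = \<alpha> * (fps_const (1 / w k) * \<beta> ^ k) \<longleftrightarrow>
        fps_const (w k) * column_series w A k =
        fps_const (w k) * (\<alpha> * (fps_const (1 / w k) * \<beta> ^ k))"
      using w[of k] by (subst mult_cancel_left) simp
    also have "fps_const (w k) * (\<alpha> * (fps_const (1 / w k) * \<beta> ^ k)) =
        (fps_const (w k) * fps_const (1 / w k)) * (\<alpha> * \<beta> ^ k)"
      by (simp only: mult_ac)
    finally show ?thesis
      by (simp only: inv scaled_column_def mult_1_left)
  qed
  then show ?thesis
    by (simp add: fps_poly_eq_iff_x_coeff[of "row_poly_series w A"] x_coeff_lift_mult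
        x_coeff_row_poly_series[OF A] x_coeff_subst_x_mult[of \<beta>, OF \<open>\<beta> $ 0 = 0\<close>] W_series_def)
qed

lemma valuation_eq_enat_iff: "valuation C = enat k \<longleftrightarrow> C \<noteq> 0 \<and> subdegree C = k"
  by (simp add: valuation_def)

lemma
  fixes w :: "nat \<Rightarrow> 'a::field"
  assumes w: "\<And>n. w n \<noteq> 0" and A: "A \<in> lower_triangular_matrices"
  shows scaled_column_nonzero: "scaled_column w A k \<noteq> 0"
    and subdegree_scaled_column: "subdegree (scaled_column w A k) = k"
proof -
  have "column_series w A k \<noteq> 0 \<and> subdegree (column_series w A k) = k"
    using valuation_column_series[OF A w] by (simp add: valuation_eq_enat_iff)
  then show "scaled_column w A k \<noteq> 0" "subdegree (scaled_column w A k) = k"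
    using w[of k] by (simp_all add: scaled_column_def)
qed

text \<open>
  Division by \<open>D\<^sub>k\<close> in the ring of power series is exact on multiples of \<open>D\<^sub>k\<close>, and \<open>D\<^sub>k\<close> divides
  \<open>D\<^sub>k\<^sub>+\<^sub>1\<close> because divisibility over a field is comparison of valuations. So a constant quotient is
  the same as a linear recurrence of order one.
\<close>
lemma W_Riordan_array_iff_geometric:
  fixes w :: "nat \<Rightarrow> 'a::field"
  assumes w: "\<And>n. w n \<noteq> 0" and A: "A \<in> lower_triangular_matrices"
  shows "W_Riordan_array w A \<longleftrightarrow> (\<exists>\<alpha> \<beta>. \<forall>k. scaled_column w A k = \<alpha> * \<beta> ^ k)"
proof -
  let ?D = "scaled_column w A"
  note nz = scaled_column_nonzero[of w, OF w A] and deg = subdegree_scaled_column[of w, OF w A]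
  have quot: "column_quotient w A k = ?D (Suc k) div ?D k" for k
    by (simp add: column_quotient_def scaled_column_def)
  show ?thesis
  proof
    assume "W_Riordan_array w A"
    then have const: "column_quotient w A k = column_quotient w A 0" for k
      unfolding W_Riordan_array_def by blast
    have step: "?D (Suc k) = ?D k * column_quotient w A 0" for k
    proof -
      have "?D k dvd ?D (Suc k)"
        using nz by (simp add: fps_dvd_iff deg)
      then show ?thesis
        using const[of k] dvd_mult_div_cancel[of "?D k" "?D (Suc k)"] by (simp add: quot)
    qed
    have "?D k = ?D 0 * column_quotient w A 0 ^ k" for k
      by (induction k) (simp_all add: step mult_ac)
    then show "\<exists>\<alpha> \<beta>. \<forall>k. ?D k = \<alpha> * \<beta> ^ k" by blast
  next
    assume "\<exists>\<alpha> \<beta>. \<forall>k. ?D k = \<alpha> * \<beta> ^ k"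
    then obtain \<alpha> \<beta> where D: "\<And>k. ?D k = \<alpha> * \<beta> ^ k" by blast
    have "column_quotient w A k = \<beta>" for k
    proof -
      have "?D (Suc k) = \<beta> * ?D k" by (simp add: D mult_ac)
      then show ?thesis using nz[of k] by (simp add: quot)
    qed
    then show "W_Riordan_array w A"
      using A by (simp add: W_Riordan_array_def)
  qed
qed

text \<open>
  The valuations of \<open>\<alpha>\<close> and \<open>\<beta>\<close> are forced: valuation is additive on products, \<open>D\<^sub>0 = \<alpha>\<close> has
  valuation 0, and \<open>D\<^sub>1 = \<alpha> \<beta>\<close> has valuation 1.
\<close>
lemma valuations_if_geometric:
  fixes w :: "nat \<Rightarrow> 'a::field"
  assumes w: "\<And>n. w n \<noteq> 0" and A: "A \<in> lower_triangular_matrices"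
    and D: "\<And>k. scaled_column w A k = \<alpha> * \<beta> ^ k"
  shows "valuation \<alpha> = 0" "valuation \<beta> = 1"
proof -
  note nz = scaled_column_nonzero[of w, OF w A] and deg = subdegree_scaled_column[of w, OF w A]
  have \<alpha>: "\<alpha> \<noteq> 0" "subdegree \<alpha> = 0"
    using nz[of 0] deg[of 0] by (simp_all add: D)
  have "\<beta> \<noteq> 0" "subdegree \<beta> = 1"
    using nz[of 1] deg[of 1] \<alpha> by (auto simp: D)
  then show "valuation \<alpha> = 0" "valuation \<beta> = 1"
    using \<alpha> by (simp_all add: valuation_def zero_enat_def one_enat_def)
qed

theorem proposition1p5:
  fixes w :: "nat \<Rightarrow> 'a::field" and A :: "nat \<Rightarrow> nat \<Rightarrow> 'a"
  assumes "w 0 = 1" and "\<And>n. w n \<noteq> 0"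
    and "A \<in> lower_triangular_matrices"
  shows "W_Riordan_array w A \<longleftrightarrow>
    (\<exists>\<alpha> \<beta> :: 'a fps. valuation \<alpha> = 0 \<and> valuation \<beta> = 1 \<and>
       row_poly_series w A = fps_lift_poly \<alpha> * subst_x_mult (W_series w) \<beta>)"
proof -
  note w = assms(2) and A = assms(3)
  have zero: "\<beta> $ 0 = 0" if "valuation \<beta> = 1" for \<beta> :: "'a fps"
    using that by (intro nth_less_subdegree_zero) (simp add: one_enat_def valuation_eq_enat_iff)
  have "W_Riordan_array w A \<longleftrightarrow> (\<exists>\<alpha> \<beta>. valuation \<alpha> = 0 \<and> valuation \<beta> = 1 \<and>
      (\<forall>k. scaled_column w A k = \<alpha> * \<beta> ^ k))"
    unfolding W_Riordan_array_iff_geometric[of w, OF w A]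
    using valuations_if_geometric[of w, OF w A] by blast
  also have "\<dots> \<longleftrightarrow> (\<exists>\<alpha> \<beta>. valuation \<alpha> = 0 \<and> valuation \<beta> = 1 \<and>
      row_poly_series w A = fps_lift_poly \<alpha> * subst_x_mult (W_series w) \<beta>)"
    using row_poly_series_factorization_iff[of w, OF w A zero] by (simp cong: conj_cong)
  finally show ?thesis .
qed

end
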